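(* For any $\epsilon>0$ there exists $\alpha=\alpha(\epsilon)>0$ such that for every integer $N\ge 1$ there exists a time-inhomogeneous birth-death process on $V_N=\{0,1,\dots,N\}$, using at each step $t\in\{0,1,2,\dots\}$ a Markov transition kernel $K^{(t)}$ on $V_N$ with $K^{(t)}(x,y)=0$ whenever $|x-y|>1$, such that for every $t$: (i) $K^{(t)}(x,y)\in[\tfrac13-\epsilon,\tfrac13+\epsilon]$ whenever $|x-y|\le 1$, except that $K^{(t)}(0,0),K^{(t)}(N,N)\in[\tfrac23-\epsilon,\tfrac23+\epsilon]$; (ii) $K^{(t)}$ has a reversible probability measure $\mu^{(t)}$ satisfying $(N+1)\mu^{(t)}(x)\in[1-\epsilon,1+\epsilon]$ for all $x\in V_N$; and such that both the total variation merging time and the relative-sup merging time at level $\tfrac12$ satisfy $$T_{TV}(\tfrac12)\ge \alpha e^{\alpha N},\qquad T_\infty(\tfrac12)\ge \alpha e^{\alpha N}.$$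
   Context: A probability measure $\mu$ is reversible for a kernel $K$ if $\mu(x)K(x,y)=\mu(y)K(y,x)$ for all $x,y$. For a sequence of kernels $\{K^{(t)}\}_{t\ge0}$ on $V_N$ write $K_{0,t}:=K^{(0)}K^{(1)}\cdots K^{(t-1)}$ (matrix product; $K_{0,0}$ is the identity). For $\delta>0$, the total variation $\delta$-merging time is $$T_{TV}(\delta):=\inf\Big\{t\ge0:\ \max_{x,y\in V_N}\|K_{0,t}(x,\cdot)-K_{0,t}(y,\cdot)\|_{TV}<\delta\Big\},$$ where $\|\mu-\nu\|_{TV}=\max_{A\subseteq V_N}|\mu(A)-\nu(A)|$, and the relative-sup $\delta$-merging time is $$T_\infty(\delta):=\inf\Big\{t\ge0:\ \max_{x,y,z\in V_N}\Big|\frac{K_{0,t}(x,z)}{K_{0,t}(y,z)}-1\Big|<\delta\Big\},$$ where the condition is understood to fail for $t$ if some $K_{0,t}(y,z)=0$. The infimum of the empty set is $+\infty$. *)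

theory Defs
  imports "HOL-Library.Extended_Real"
begin

(* A kernel or measure on a finite set V is a real-valued function; only its values on V matter,
   and every quantifier, sum and maximum below is restricted to V. *)

definition prob_vector :: "'a set \<Rightarrow> ('a \<Rightarrow> real) \<Rightarrow> bool" where
  "prob_vector V \<mu> \<longleftrightarrow> (\<forall>x\<in>V. 0 \<le> \<mu> x) \<and> (\<Sum>x\<in>V. \<mu> x) = 1"

definition markov_kernel :: "'a set \<Rightarrow> ('a \<Rightarrow> 'a \<Rightarrow> real) \<Rightarrow> bool" where
  "markov_kernel V K \<longleftrightarrow> (\<forall>x\<in>V. prob_vector V (K x))"

definition reversible_for :: "'a set \<Rightarrow> ('a \<Rightarrow> 'a \<Rightarrow> real) \<Rightarrow> ('a \<Rightarrow> real) \<Rightarrow> bool" where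
  "reversible_for V K \<mu> \<longleftrightarrow> (\<forall>x\<in>V. \<forall>y\<in>V. \<mu> x * K x y = \<mu> y * K y x)"

definition birth_death_kernel :: "nat \<Rightarrow> (nat \<Rightarrow> nat \<Rightarrow> real) \<Rightarrow> bool" where
  "birth_death_kernel N K \<longleftrightarrow> markov_kernel {0..N} K \<and>
     (\<forall>x\<in>{0..N}. \<forall>y\<in>{0..N}. \<bar>int x - int y\<bar> > 1 \<longrightarrow> K x y = 0)"

(* iter_kernel V K t is the matrix product K 0 * K 1 * ... * K (t - 1). *)
fun iter_kernel :: "'a set \<Rightarrow> (nat \<Rightarrow> 'a \<Rightarrow> 'a \<Rightarrow> real) \<Rightarrow> nat \<Rightarrow> 'a \<Rightarrow> 'a \<Rightarrow> real" where
  "iter_kernel V K 0 x y = (if x = y then 1 else 0)"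
| "iter_kernel V K (Suc t) x y = (\<Sum>z\<in>V. iter_kernel V K t x z * K t z y)"

definition tv_dist :: "'a set \<Rightarrow> ('a \<Rightarrow> real) \<Rightarrow> ('a \<Rightarrow> real) \<Rightarrow> real" where
  "tv_dist V \<mu> \<nu> = (MAX A\<in>Pow V. \<bar>(\<Sum>x\<in>A. \<mu> x) - (\<Sum>x\<in>A. \<nu> x)\<bar>)"

(* The infima are taken in enat, where Inf {} is infinity. *)
definition tv_merging_time :: "'a set \<Rightarrow> (nat \<Rightarrow> 'a \<Rightarrow> 'a \<Rightarrow> real) \<Rightarrow> real \<Rightarrow> enat" where
  "tv_merging_time V K \<delta> = Inf {enat t | t.
     (MAX (x, y)\<in>V \<times> V. tv_dist V (iter_kernel V K t x) (iter_kernel V K t y)) < \<delta>}"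

definition relsup_merging_time :: "'a set \<Rightarrow> (nat \<Rightarrow> 'a \<Rightarrow> 'a \<Rightarrow> real) \<Rightarrow> real \<Rightarrow> enat" where
  "relsup_merging_time V K \<delta> = Inf {enat t | t.
     (\<forall>y\<in>V. \<forall>z\<in>V. iter_kernel V K t y z \<noteq> 0) \<and>
     (MAX (x, y, z)\<in>V \<times> V \<times> V. \<bar>iter_kernel V K t x z / iter_kernel V K t y z - 1\<bar>) < \<delta>}"

end

theory Submission
  imports Defs
begin

text \<open>
  The process is a flashing ratchet. At time \<open>t\<close> the reversible measure and the edge
  conductances of the walk are perturbed according to the parity of \<open>x + t\<close>. Each kernel alone
  has no effective drift, but the parity class of \<open>x + t\<close> seen by the walker changes
  exactly when the walker holds, and this correlation yields a drift of order \<open>\<delta>\<^sup>2\<close> whose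
  sign depends on whether the large conductances follow the sites of large or of small measure.
  Choosing the phase so that the drift points to \<open>0\<close> on the left half and to \<open>N\<close> on
  the right half, an exponential supermartingale shows that walkers started at the two ends need
  exponentially long to leave their halves.
\<close>

section \<open>Inhomogeneous chains and lower bounds on merging times\<close>

lemma ereal_le_Inf_enat:
  assumes "\<And>t. P t \<Longrightarrow> T \<le> real t"
  shows "ereal T \<le> ereal_of_enat (Inf {enat t | t. P t})"
proof (cases "{enat t | t. P t} = {}")
  case True
  then show ?thesis by (simp add: top_enat_def)
next
  case False
  then obtain k where "k \<in> {enat t | t. P t}" by blast
  then have "Inf {enat t | t. P t} \<in> {enat t | t. P t}" by (rule wellorder_InfI)
  then obtain t where "Inf {enat t | t. P t} = enat t" "P t" by blast
  then show ?thesis using assms by simp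
qed

lemma iter_kernel_prob_vector:
  assumes "finite V" "\<And>t. markov_kernel V (K t)" "x \<in> V"
  shows "prob_vector V (iter_kernel V K t x)"
proof (induction t)
  case 0
  then show ?case using assms by (simp add: prob_vector_def)
next
  case (Suc t)
  have "(\<Sum>y\<in>V. \<Sum>z\<in>V. iter_kernel V K t x z * K t z y)
      = (\<Sum>z\<in>V. iter_kernel V K t x z * (\<Sum>y\<in>V. K t z y))"
    by (subst sum.swap) (simp add: sum_distrib_left)
  also have "\<dots> = (\<Sum>z\<in>V. iter_kernel V K t x z)"
    using assms(2)[of t] by (intro sum.cong) (auto simp: markov_kernel_def prob_vector_def)
  finally show ?case using Suc assms(2)[of t]
    by (auto simp: prob_vector_def markov_kernel_def intro!: sum_nonneg)
qed

text \<open>Values of \<open>f\<close> off the support of \<open>K x\<close> are unconstrained, so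
  for a nearest-neighbour kernel only \<open>x\<close> and its neighbours matter.\<close>

lemma markov_average_le:
  assumes "finite V" "markov_kernel V K" "x \<in> V"
    and "\<And>y. y \<in> V \<Longrightarrow> K x y \<noteq> 0 \<Longrightarrow> f y \<le> c"
  shows "(\<Sum>y\<in>V. K x y * f y) \<le> c"
proof -
  have "prob_vector V (K x)" using assms by (simp add: markov_kernel_def)
  then have K: "\<And>y. y \<in> V \<Longrightarrow> 0 \<le> K x y" "(\<Sum>y\<in>V. K x y) = 1"
    by (auto simp: prob_vector_def)
  have "(\<Sum>y\<in>V. K x y * f y) \<le> (\<Sum>y\<in>V. K x y * c)"
  proof (rule sum_mono)
    fix y assume y: "y \<in> V"
    show "K x y * f y \<le> K x y * c"
      using assms(4)[OF y] K(1)[OF y] by (cases "K x y = 0") (auto intro: mult_left_mono)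
  qed
  also have "\<dots> = c" using K(2) by (simp flip: sum_distrib_right)
  finally show ?thesis .
qed

text \<open>\<open>iter_kernel\<close> multiplies the newest kernel on the right, so averaging
  \<open>step\<close> over the law at time \<open>t\<close> gives the induction step. The constant
  \<open>c\<close> admits supermartingales that lose a bounded amount per step.\<close>

lemma iter_kernel_expectation_le:
  assumes "finite V" "\<And>t. markov_kernel V (K t)" "x \<in> V"
    and step: "\<And>t z. z \<in> V \<Longrightarrow> (\<Sum>y\<in>V. K t z y * h (Suc t) y) \<le> h t z + c"
  shows "(\<Sum>y\<in>V. iter_kernel V K t x y * h t y) \<le> h 0 x + c * real t"
proof (induction t)
  case 0
  have "(\<Sum>y\<in>V. (if x = y then 1 else 0) * h 0 y) = (\<Sum>y\<in>V. if x = y then h 0 y else 0)"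
    by (intro sum.cong) auto
  then show ?case using assms by simp
next
  case (Suc t)
  let ?P = "iter_kernel V K t x"
  have P: "\<And>z. z \<in> V \<Longrightarrow> 0 \<le> ?P z" "sum ?P V = 1"
    using iter_kernel_prob_vector[of V K x t] assms by (auto simp: prob_vector_def)
  have "(\<Sum>y\<in>V. iter_kernel V K (Suc t) x y * h (Suc t) y)
      = (\<Sum>y\<in>V. \<Sum>z\<in>V. ?P z * (K t z y * h (Suc t) y))"
    by (simp add: sum_distrib_right mult.assoc)
  also have "\<dots> = (\<Sum>z\<in>V. ?P z * (\<Sum>y\<in>V. K t z y * h (Suc t) y))"
    by (subst sum.swap) (simp add: sum_distrib_left)
  also have "\<dots> \<le> (\<Sum>z\<in>V. ?P z * (h t z + c))"
    by (intro sum_mono mult_left_mono step P)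
  also have "\<dots> = (\<Sum>z\<in>V. ?P z * h t z) + c"
    using P(2) by (simp add: distrib_left sum.distrib flip: sum_distrib_right)
  finally show ?case using Suc by (simp add: algebra_simps)
qed

text \<open>Markov's inequality for the process \<open>h\<close>; in use, \<open>B\<close> is the
  far region, where \<open>h\<close> sits at its cap \<open>M\<close>.\<close>

lemma iter_kernel_markov_ineq:
  assumes "finite V" "\<And>t. markov_kernel V (K t)" "x \<in> V"
    and "\<And>t z. z \<in> V \<Longrightarrow> (\<Sum>y\<in>V. K t z y * h (Suc t) y) \<le> h t z + c"
    and "\<And>t y. y \<in> V \<Longrightarrow> 0 \<le> h t y" "B \<subseteq> V" "\<And>y. y \<in> B \<Longrightarrow> h t y = M" "M > 0"
  shows "(\<Sum>y\<in>B. iter_kernel V K t x y) \<le> (h 0 x + c * real t) / M"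
proof -
  have P: "\<And>z. z \<in> V \<Longrightarrow> 0 \<le> iter_kernel V K t x z"
    using iter_kernel_prob_vector[of V K x t] assms by (auto simp: prob_vector_def)
  have "(\<Sum>y\<in>B. iter_kernel V K t x y) * M = (\<Sum>y\<in>B. iter_kernel V K t x y * h t y)"
    using assms by (simp add: sum_distrib_right)
  also have "\<dots> \<le> (\<Sum>y\<in>V. iter_kernel V K t x y * h t y)"
    by (rule sum_mono2) (use assms P in auto)
  also have "\<dots> \<le> h 0 x + c * real t"
    by (rule iter_kernel_expectation_le) (use assms in auto)
  finally show ?thesis using assms by (simp add: field_simps)
qed

text \<open>One test set \<open>A\<close> serves both distances: the gap between its masses is at
  least 1/2, and relative-sup merging would bound the first mass by 3/2 times the second, giving 3/4
  \<le> 3/8.\<close>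

lemma merging_times_ge:
  assumes "finite V" "x \<in> V" "y \<in> V" "A \<subseteq> V"
    and prob: "\<And>t. prob_vector V (iter_kernel V K t y)"
    and sep: "\<And>t. real t < T \<Longrightarrow>
      3/4 \<le> (\<Sum>z\<in>A. iter_kernel V K t x z) \<and> (\<Sum>z\<in>A. iter_kernel V K t y z) \<le> 1/4"
  shows "ereal T \<le> ereal_of_enat (tv_merging_time V K (1/2))"
    and "ereal T \<le> ereal_of_enat (relsup_merging_time V K (1/2))"
proof -
  show "ereal T \<le> ereal_of_enat (tv_merging_time V K (1/2))"
    unfolding tv_merging_time_def
  proof (rule ereal_le_Inf_enat)
    fix t
    let ?d = "\<lambda>(x, y). tv_dist V (iter_kernel V K t x) (iter_kernel V K t y)"
    assume t: "(MAX p\<in>V \<times> V. ?d p) < 1/2"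
    show "T \<le> real t"
    proof (rule ccontr)
      assume "\<not> T \<le> real t"
      then have "1/2 \<le> \<bar>(\<Sum>z\<in>A. iter_kernel V K t x z) - (\<Sum>z\<in>A. iter_kernel V K t y z)\<bar>"
        using sep[of t] by linarith
      also have "\<dots> \<le> ?d (x, y)"
        unfolding tv_dist_def prod.case using assms by (intro Max_ge) auto
      also have "\<dots> \<le> (MAX p\<in>V \<times> V. ?d p)"
        using assms by (intro Max_ge finite_imageI) auto
      finally show False using t by simp
    qed
  qed
  show "ereal T \<le> ereal_of_enat (relsup_merging_time V K (1/2))"
    unfolding relsup_merging_time_def
  proof (rule ereal_le_Inf_enat)
    fix t
    let ?P = "iter_kernel V K t"
    let ?d = "\<lambda>(x, y, z). \<bar>?P x z / ?P y z - 1\<bar>"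
    assume t: "(\<forall>y\<in>V. \<forall>z\<in>V. ?P y z \<noteq> 0) \<and> (MAX p\<in>V \<times> V \<times> V. ?d p) < 1/2"
    show "T \<le> real t"
    proof (rule ccontr)
      assume nt: "\<not> T \<le> real t"
      have "?P x z \<le> 3/2 * ?P y z" if "z \<in> A" for z
      proof -
        have z: "z \<in> V" using that assms by auto
        have "?d (x, y, z) \<le> (MAX p\<in>V \<times> V \<times> V. ?d p)"
          using assms z by (intro Max_ge finite_imageI imageI) auto
        then have "?d (x, y, z) < 1/2" by (rule le_less_trans) (use t in blast)
        then have "?P x z / ?P y z \<le> 3/2" unfolding prod.case by linarith
        moreover have "0 < ?P y z"
          using t prob[of t] z assms by (force simp: prob_vector_def less_le)
        ultimately show ?thesis by (simp add: field_simps)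
      qed
      then have "(\<Sum>z\<in>A. ?P x z) \<le> 3/2 * (\<Sum>z\<in>A. ?P y z)"
        unfolding sum_distrib_left by (intro sum_mono)
      then show False using sep[of t] nt by linarith
    qed
  qed
qed

section \<open>The alternating kernels and their reversible measures\<close>

locale ratchet =
  fixes \<delta> :: real and N m :: nat
  assumes \<delta>_pos: "0 < \<delta>" and \<delta>_le: "\<delta> \<le> 1/10" and m_le: "2 * m < N"
begin

lemma m_less: "m < N"
  using m_le by simp

text \<open>The unnormalised reversible measure. The factor 3, against conductances near 1, makes
  the jump probabilities close to 1/3.\<close>

definition site :: "nat \<Rightarrow> nat \<Rightarrow> real" where
  "site t x = (if even (x + t) then 3 * (1 - \<delta>) else 3 * (1 + \<delta>))"

text \<open>Conductance of the edge between \<open>x\<close> and \<open>x + 1\<close>. It is light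
  together with its left endpoint for \<open>x\<close> \<le> \<open>m\<close> and with its right
  endpoint beyond. Hence, except at the junction \<open>m + 1\<close>, an interior step away from
  the nearer end has probability exactly 1/3, and only the step towards that end is
  perturbed.\<close>

definition edge :: "nat \<Rightarrow> nat \<Rightarrow> real" where
  "edge t x = (if even (x + t) \<longleftrightarrow> x \<le> m then 1 - \<delta> else 1 + \<delta>)"

definition up :: "nat \<Rightarrow> nat \<Rightarrow> real" where
  "up t x = (if x < N then edge t x / site t x else 0)"

definition down :: "nat \<Rightarrow> nat \<Rightarrow> real" where
  "down t x = (if 0 < x then edge t (x - 1) / site t x else 0)"

definition kernel :: "nat \<Rightarrow> nat \<Rightarrow> nat \<Rightarrow> real" where
  "kernel t x y = (if y = Suc x then up t x else if x = Suc y then down t x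
     else if x = y then 1 - up t x - down t x else 0)"

lemma site_pos: "0 < site t x"
  using \<delta>_pos \<delta>_le by (auto simp: site_def)

lemma ratio_bounds: "\<bar>edge t y / site t x - 1/3\<bar> \<le> \<delta>"
proof -
  have sq: "\<delta> * \<delta> \<le> \<delta> * (1/10)" using \<delta>_pos \<delta>_le by (intro mult_left_mono) auto
  have "(1 - 3 * \<delta>) * site t x \<le> 3 * edge t y \<and> 3 * edge t y \<le> (1 + 3 * \<delta>) * site t x"
    using \<delta>_pos \<delta>_le sq by (auto simp: site_def edge_def algebra_simps)
  then have "1 - 3 * \<delta> \<le> 3 * edge t y / site t x" "3 * edge t y / site t x \<le> 1 + 3 * \<delta>"
    by (simp_all only: pos_le_divide_eq pos_divide_le_eq site_pos)
  then show ?thesis by linarith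
qed

lemma up_bounds: "x < N \<Longrightarrow> \<bar>up t x - 1/3\<bar> \<le> \<delta>"
  and down_bounds: "0 < x \<Longrightarrow> \<bar>down t x - 1/3\<bar> \<le> \<delta>"
  using ratio_bounds by (auto simp: up_def down_def)

lemma up_N [simp]: "up t N = 0" and down_0 [simp]: "down t 0 = 0"
  by (auto simp: up_def down_def)

lemma rates_nonneg: "0 \<le> up t x" "0 \<le> down t x" "0 \<le> 1 - up t x - down t x"
proof -
  have "0 \<le> up t x \<and> up t x \<le> 1/2"
    using up_bounds[of x t] \<delta>_le by (cases "x < N") (auto simp: up_def)
  moreover have "0 \<le> down t x \<and> down t x \<le> 1/2"
    using down_bounds[of x t] \<delta>_le by (cases "0 < x") (auto simp: down_def)
  ultimately show "0 \<le> up t x" "0 \<le> down t x" "0 \<le> 1 - up t x - down t x" by auto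
qed

lemma kernel_nonneg: "0 \<le> kernel t x y"
  using rates_nonneg by (auto simp: kernel_def)

text \<open>The ends need no separate formula: \<open>Suc x\<close> at \<open>N\<close> and the
  truncated \<open>x - 1\<close> at 0 both carry weight zero.\<close>

lemma kernel_average:
  assumes "x \<le> N"
  shows "(\<Sum>y\<in>{0..N}. kernel t x y * f y)
    = up t x * f (Suc x) + down t x * f (x - 1) + (1 - up t x - down t x) * f x"
proof -
  have "(\<Sum>y\<in>{0..N}. kernel t x y * f y)
    = (\<Sum>y\<in>{0..N}. (if y = Suc x then up t x * f y else 0)
       + (if y = x - 1 then down t x * f y else 0)
       + (if y = x then (1 - up t x - down t x) * f y else 0))"
    by (intro sum.cong) (cases x; auto simp: kernel_def)+
  also have "\<dots> = up t x * f (Suc x) + down t x * f (x - 1) + (1 - up t x - down t x) * f x"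
    using assms by (cases "x = N") (auto simp: sum.distrib)
  finally show ?thesis .
qed

lemma markov_kernel: "markov_kernel {0..N} (kernel t)"
  unfolding markov_kernel_def prob_vector_def
  using kernel_average[of _ t "\<lambda>_. 1"] kernel_nonneg by auto

lemma birth_death: "birth_death_kernel N (kernel t)"
  using markov_kernel by (auto simp: birth_death_kernel_def kernel_def)

lemma kernel_bounds:
  assumes "x \<le> N" "y \<le> N" "\<bar>int x - int y\<bar> \<le> 1" "(x, y) \<noteq> (0, 0)" "(x, y) \<noteq> (N, N)"
  shows "\<bar>kernel t x y - 1/3\<bar> \<le> 2 * \<delta>"
proof -
  consider "y = Suc x" | "x = Suc y" | "x = y" using assms(3) by linarith
  then show ?thesis
  proof cases
    case 1
    then show ?thesis using up_bounds[of x t] assms \<delta>_pos by (simp add: kernel_def)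
  next
    case 2
    then show ?thesis using down_bounds[of x t] assms \<delta>_pos by (simp add: kernel_def)
  next
    case 3
    then have "0 < x" "x < N" using assms by auto
    then show ?thesis using up_bounds[of x t] down_bounds[of x t] 3 by (simp add: kernel_def)
  qed
qed

lemma kernel_bounds_ends: "\<bar>kernel t 0 0 - 2/3\<bar> \<le> \<delta>" "\<bar>kernel t N N - 2/3\<bar> \<le> \<delta>"
  using up_bounds[of 0 t] down_bounds[of N t] m_less by (auto simp: kernel_def)

text \<open>For neighbours, both sides are the conductance of the joining edge.\<close>

lemma site_kernel_sym:
  assumes "x \<le> N" "y \<le> N"
  shows "site t x * kernel t x y = site t y * kernel t y x"
  using assms site_pos[of t x] site_pos[of t y]
  by (auto simp: kernel_def up_def down_def)

lemma reversible_measure: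
  "\<exists>\<mu>. prob_vector {0..N} \<mu> \<and> reversible_for {0..N} (kernel t) \<mu> \<and>
     (\<forall>x\<in>{0..N}. \<bar>(real N + 1) * \<mu> x - 1\<bar> \<le> 3 * \<delta>)"
proof -
  define Z where "Z = (\<Sum>x\<in>{0..N}. site t x)"
  have s: "3 * (1 - \<delta>) \<le> site t x" "site t x \<le> 3 * (1 + \<delta>)" for x
    using \<delta>_pos by (auto simp: site_def)
  have Zl: "(real N + 1) * (3 * (1 - \<delta>)) \<le> Z"
    using sum_bounded_below[of "{0..N}" "3 * (1 - \<delta>)" "site t"] s by (simp add: Z_def add.commute)
  have Zu: "Z \<le> (real N + 1) * (3 * (1 + \<delta>))"
    using sum_bounded_above[of "{0..N}" "site t" "3 * (1 + \<delta>)"] s by (simp add: Z_def add.commute)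
  have Z: "0 < Z" using site_pos by (auto simp: Z_def intro!: sum_pos)
  \<comment> \<open>These are the gaps in (1 + \<delta>) \<le> (1 + 3\<delta>)(1 - \<delta>) and (1
    - 3\<delta>)(1 + \<delta>) \<le> 1 - \<delta>, which compare a weight with the mean
    weight.\<close>
  have sq: "0 \<le> \<delta> * (1 - 3 * \<delta>)" "0 \<le> \<delta> * (1 + 3 * \<delta>)"
    using \<delta>_pos \<delta>_le by auto
  have "\<bar>(real N + 1) * (site t x / Z) - 1\<bar> \<le> 3 * \<delta>" for x
  proof -
    have "(1 - 3 * \<delta>) * Z \<le> (1 - 3 * \<delta>) * ((real N + 1) * (3 * (1 + \<delta>)))"
      using \<delta>_le Zu by (intro mult_left_mono) auto
    also have "\<dots> = (real N + 1) * (3 * ((1 - 3 * \<delta>) * (1 + \<delta>)))" by simp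
    also have "\<dots> \<le> (real N + 1) * (3 * (1 - \<delta>))"
      using sq by (intro mult_left_mono) (auto simp: algebra_simps)
    also have "\<dots> \<le> (real N + 1) * site t x" using s by (intro mult_left_mono) auto
    finally have 1: "(1 - 3 * \<delta>) * Z \<le> (real N + 1) * site t x" .
    have "(real N + 1) * site t x \<le> (real N + 1) * (3 * (1 + \<delta>))"
      using s by (intro mult_left_mono) auto
    also have "\<dots> \<le> (real N + 1) * (3 * ((1 + 3 * \<delta>) * (1 - \<delta>)))"
      using sq by (intro mult_left_mono) (auto simp: algebra_simps)
    also have "\<dots> = (1 + 3 * \<delta>) * ((real N + 1) * (3 * (1 - \<delta>)))" by simp
    also have "\<dots> \<le> (1 + 3 * \<delta>) * Z"
      using \<delta>_pos Zl by (intro mult_left_mono) auto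
    finally have 2: "(real N + 1) * site t x \<le> (1 + 3 * \<delta>) * Z" .
    have "1 - 3 * \<delta> \<le> (real N + 1) * site t x / Z" "(real N + 1) * site t x / Z \<le> 1 + 3 * \<delta>"
      using 1 2 Z by (simp_all add: pos_le_divide_eq pos_divide_le_eq)
    then show ?thesis by (simp add: abs_le_iff)
  qed
  moreover have "prob_vector {0..N} (\<lambda>x. site t x / Z)"
    using Z site_pos by (auto simp: prob_vector_def less_imp_le Z_def simp flip: sum_divide_distrib)
  moreover have "reversible_for {0..N} (kernel t) (\<lambda>x. site t x / Z)"
    using site_kernel_sym by (auto simp: reversible_for_def)
  ultimately show ?thesis by blast
qed

section \<open>Exponential supermartingale with a parity correction\<close>

text \<open>
  \<open>rate ^ x * corr (even (x + t))\<close> is a supermartingale for the walk in the left half: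
  \<open>corr False\<close> is chosen to give equality at even \<open>x + t\<close>, and the
  inequality at odd \<open>x + t\<close> then has slack of order \<open>\<delta> ^ 4\<close>.
\<close>
definition rate :: real where
  "rate = 1 + \<delta>\<^sup>2"

definition corr :: "bool \<Rightarrow> real" where
  "corr b = (if b then 1 - 3 * \<delta> else 3 * (1 - \<delta>) - (1 - \<delta>) * rate - (1 + \<delta>) / rate)"

lemma rate_gt_1: "1 < rate" and rate_le_2: "rate \<le> 2"
proof -
  show "1 < rate" using \<delta>_pos by (simp add: rate_def)
  have "\<delta>\<^sup>2 \<le> 1" using \<delta>_pos \<delta>_le by (intro power_le_one) auto
  then show "rate \<le> 2" by (simp add: rate_def)
qed

lemma corr_True: "corr True = 1 - 3 * \<delta>"
  by (simp add: corr_def)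

lemma rate_corr_False: "rate * corr False = 3 * (1 - \<delta>) * rate - (1 - \<delta>) * rate\<^sup>2 - (1 + \<delta>)"
  using rate_gt_1 by (simp add: corr_def field_simps power2_eq_square)

text \<open>The two corrections differ only at order \<delta>^3, with \<open>corr False\<close> the
  larger; this keeps both between 1/2 and 1.\<close>

lemma corr_False_excess:
  "rate * (corr False - corr True) = \<delta> ^ 3 * (2 - \<delta> * (1 - \<delta>))"
proof -
  have "rate * (corr False - corr True) = rate * corr False - rate * (1 - 3 * \<delta>)"
    by (simp add: corr_def algebra_simps)
  also have "\<dots> = \<delta> ^ 3 * (2 - \<delta> * (1 - \<delta>))"
    unfolding rate_corr_False unfolding rate_def by algebra
  finally show ?thesis .
qed

lemma corr_bounds: "1/2 \<le> corr b" "corr b \<le> 1"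
proof -
  have True_bounds: "1/2 \<le> corr True" "corr True \<le> 1 - 3 * \<delta>" using \<delta>_le by (auto simp: corr_def)
  have d: "0 \<le> \<delta> * (1 - \<delta>)" "\<delta> * (1 - \<delta>) \<le> 1" using \<delta>_pos \<delta>_le by (auto intro: mult_le_one)
  have "0 \<le> rate * (corr False - corr True)"
    unfolding corr_False_excess using \<delta>_pos d by auto
  then have lo: "corr True \<le> corr False" using rate_gt_1 by (simp add: zero_le_mult_iff)
  have "corr False - corr True \<le> rate * (corr False - corr True)"
    using rate_gt_1 lo by (simp add: mult_le_cancel_right1)
  also have "\<dots> \<le> \<delta> ^ 3 * 2"
    unfolding corr_False_excess using \<delta>_pos d by (intro mult_left_mono) auto
  also have "\<dots> \<le> \<delta> * 2"
    using \<delta>_pos \<delta>_le power_decreasing[of 1 3 \<delta>] by simp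
  finally have "corr False \<le> 1" using True_bounds \<delta>_pos by linarith
  then show "1/2 \<le> corr b" "corr b \<le> 1" using True_bounds lo \<delta>_pos by (cases b; simp)+
qed

text \<open>Holding at even \<open>x + t\<close> has weight 1 - 3\<delta>. Normalising
  \<open>corr True\<close> to the same number lets it cancel when solving for
  \<open>corr False\<close>.\<close>

lemma corr_even:
  "(1 - \<delta>) * rate\<^sup>2 * corr True + (1 + \<delta>) * corr True + (1 - 3 * \<delta>) * (rate * corr False)
    = 3 * (1 - \<delta>) * (rate * corr True)"
  unfolding rate_corr_False corr_True by algebra

text \<open>Multiplying by \<open>rate\<close> turns the slack into an explicit polynomial in
  \<delta>. It is positive because \<open>rate - 1\<close> is of the order \<delta>^2 of the drift,
  small enough for the convexity of the exponential not to outweigh that drift.\<close>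

lemma corr_odd:
  "(1 + \<delta>) * rate\<^sup>2 * corr False + (1 - \<delta>) * corr False + (1 + 3 * \<delta>) * (rate * corr True)
    \<le> 3 * (1 + \<delta>) * (rate * corr False)"
proof -
  have "0 \<le> \<delta> ^ 4 * (10 + 12 * \<delta>\<^sup>2 + 3 * \<delta> ^ 4 - \<delta> ^ 6)"
    using \<delta>_pos \<delta>_le power_le_one[of \<delta> 6]
    by (intro mult_nonneg_nonneg) (auto intro: order_trans add_increasing2)
  also have "\<dots> = (rate * corr False) * (3 * (1 + \<delta>) * rate - (1 + \<delta>) * rate\<^sup>2 - (1 - \<delta>))
      - (1 + 3 * \<delta>) * rate\<^sup>2 * corr True"
    unfolding rate_corr_False corr_True unfolding rate_def by algebra
  also have "\<dots> = rate * (3 * (1 + \<delta>) * (rate * corr False) - ((1 + \<delta>) * rate\<^sup>2 * corr False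
      + (1 - \<delta>) * corr False + (1 + 3 * \<delta>) * (rate * corr True)))"
    by algebra
  finally show ?thesis using rate_gt_1 by (simp add: zero_le_mult_iff)
qed

text \<open>Here \<open>e\<close> is the outward and \<open>e'\<close> the inward conductance at
  distance \<open>Suc k\<close> from the end, so both halves are covered. A jump preserves the
  parity of \<open>x + t\<close> and a hold flips it; clearing \<open>site t x\<close> and
  \<open>rate ^ k\<close> leaves \<open>corr_even\<close> or \<open>corr_odd\<close>.\<close>

lemma drift_step:
  assumes "b \<longleftrightarrow> even (x + t)"
    and "e = (if b then 1 - \<delta> else 1 + \<delta>)" "e' = (if b then 1 + \<delta> else 1 - \<delta>)"
  shows "e / site t x * (rate ^ Suc (Suc k) * corr b) + e' / site t x * (rate ^ k * corr b)
     + (1 - e / site t x - e' / site t x) * (rate ^ Suc k * corr (\<not> b)) \<le> rate ^ Suc k * corr b"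
    (is "?L \<le> _")
proof -
  have "site t x * ?L = rate ^ k * (e * rate\<^sup>2 * corr b + e' * corr b
      + (site t x - e - e') * (rate * corr (\<not> b)))"
    using site_pos[of t x] by (simp add: field_simps power2_eq_square)
  also have "\<dots> \<le> rate ^ k * (site t x * (rate * corr b))"
    using corr_even corr_odd rate_gt_1 assms
    by (intro mult_left_mono) (auto simp: site_def algebra_simps)
  finally have "site t x * ?L \<le> site t x * (rate ^ Suc k * corr b)"
    by (simp add: mult_ac)
  then show ?thesis using site_pos by simp
qed

section \<open>The capped potential and its one-step bounds\<close>

text \<open>
  Capping at \<open>cap\<close> makes the supermartingale constant beyond distance \<open>m\<close> from the
  starting end, where the drift is wrong; at the end itself the loss is at most 2 per step.
\<close>
definition cap :: real where
  "cap = rate ^ m / 2"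

definition pot :: "(nat \<Rightarrow> nat) \<Rightarrow> nat \<Rightarrow> nat \<Rightarrow> real" where
  "pot d t x = min (rate ^ d x * corr (even (x + t))) cap"

lemma pot_nonneg: "0 \<le> pot d t x"
  using corr_bounds(1)[of "even (x + t)"] rate_gt_1 by (simp add: pot_def cap_def)

text \<open>The 1/2 in \<open>cap\<close> is the lower bound of \<open>corr\<close>, so the cap is
  reached at distance \<open>m\<close> for either parity.\<close>

lemma pot_far: "m \<le> d x \<Longrightarrow> pot d t x = cap"
proof -
  assume "m \<le> d x"
  then have "rate ^ m * (1/2) \<le> rate ^ d x * corr (even (x + t))"
    using corr_bounds(1) rate_gt_1 by (intro mult_mono power_increasing) auto
  then show ?thesis by (simp add: pot_def cap_def)
qed

lemma pot_le: "d x \<le> 1 \<Longrightarrow> pot d t x \<le> 2"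
proof -
  assume "d x \<le> 1"
  then have "rate ^ d x \<le> 2" using rate_le_2 by (cases "d x") auto
  then have "rate ^ d x * corr (even (x + t)) \<le> 2 * 1"
    using corr_bounds[of "even (x + t)"] by (intro mult_mono) auto
  then show ?thesis by (simp add: pot_def)
qed

text \<open>At the end itself no inward step compensates the outward one, so the bound 2 on nearby
  values is used instead; it is the source of the loss per step.\<close>

lemma pot_average_near:
  assumes "x \<le> N" "\<And>y. y \<le> N \<Longrightarrow> \<bar>int x - int y\<bar> \<le> 1 \<Longrightarrow> d y \<le> 1"
  shows "(\<Sum>y\<in>{0..N}. kernel t x y * pot d (Suc t) y) \<le> pot d t x + 2"
proof -
  have "(\<Sum>y\<in>{0..N}. kernel t x y * pot d (Suc t) y) \<le> 2"
    using assms by (intro markov_average_le markov_kernel pot_le)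
      (auto simp: kernel_def split: if_splits)
  then show ?thesis using pot_nonneg[of d t x] by simp
qed

lemma pot_average_le_cap:
  assumes "x \<le> N"
  shows "(\<Sum>y\<in>{0..N}. kernel t x y * pot d (Suc t) y) \<le> cap"
  using assms by (intro markov_average_le markov_kernel) (auto simp: pot_def)

text \<open>The mean of a minimum is at most the minimum of the means: the uncapped process is
  controlled by the hypothesis, the other term by \<open>cap\<close>.\<close>

lemma pot_average_drift:
  assumes "x \<le> N" and "up t x * (rate ^ d (Suc x) * corr (even (x + t)))
     + down t x * (rate ^ d (x - 1) * corr (even (x + t)))
     + (1 - up t x - down t x) * (rate ^ d x * corr (odd (x + t)))
     \<le> rate ^ d x * corr (even (x + t))" "0 < x"
  shows "(\<Sum>y\<in>{0..N}. kernel t x y * pot d (Suc t) y) \<le> pot d t x + 2"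
proof -
  have "even (x - 1 + Suc t) \<longleftrightarrow> even (x + t)" using \<open>0 < x\<close> by (cases x) auto
  then have "(\<Sum>y\<in>{0..N}. kernel t x y * pot d (Suc t) y)
    \<le> up t x * (rate ^ d (Suc x) * corr (even (x + t)))
     + down t x * (rate ^ d (x - 1) * corr (even (x + t)))
     + (1 - up t x - down t x) * (rate ^ d x * corr (odd (x + t)))"
    unfolding kernel_average[OF \<open>x \<le> N\<close>]
    by (intro add_mono mult_left_mono rates_nonneg) (auto simp: pot_def)
  with assms(2) pot_average_le_cap[OF \<open>x \<le> N\<close>, of t d] show ?thesis
    unfolding pot_def[of d t x] by linarith
qed

lemma left_step:
  assumes "x \<le> N"
  shows "(\<Sum>y\<in>{0..N}. kernel t x y * pot id (Suc t) y) \<le> pot id t x + 2"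
proof -
  consider "x = 0" | "m < x" | "0 < x" "x \<le> m" by linarith
  then show ?thesis
  proof cases
    case 1
    then show ?thesis by (intro pot_average_near) auto
  next
    case 2
    then show ?thesis using pot_average_le_cap[OF assms, of t id] pot_far[of id x t] by simp
  next
    case 3
    then have "even (x - 1 + t) \<longleftrightarrow> odd (x + t)" by (cases x) auto
    then show ?thesis
      using drift_step[OF refl refl refl, of x t "x - 1"] 3 m_less
      by (intro pot_average_drift) (auto simp: up_def down_def edge_def)
  qed
qed

lemma right_step:
  assumes "x \<le> N"
  shows "(\<Sum>y\<in>{0..N}. kernel t x y * pot (\<lambda>x. N - x) (Suc t) y) \<le> pot (\<lambda>x. N - x) t x + 2"
proof -
  consider "x = N" | "x \<le> Suc m" | "Suc m < x" "x < N" using assms by linarith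
  then show ?thesis
  proof cases
    case 1
    then show ?thesis by (intro pot_average_near) auto
  next
    case 2
    \<comment> \<open>The junction \<open>m + 1\<close>, whose two edges follow opposite phases,
      must lie in the capped zone; 2\<open>m\<close> < \<open>N\<close> is exactly what ensures
      this.\<close>
    then have "m \<le> N - x" using m_le by linarith
    then show ?thesis
      using pot_average_le_cap[OF assms, of t "\<lambda>x. N - x"] pot_far[of "\<lambda>x. N - x" x t] by simp
  next
    case 3
    have "N - (x - 1) = Suc (Suc (N - Suc x))" "N - x = Suc (N - Suc x)" using 3 by auto
    moreover have "even (x - 1 + t) \<longleftrightarrow> odd (x + t)" using 3 by (cases x) auto
    ultimately show ?thesis
      using drift_step[OF refl refl refl, of x t "N - Suc x"] 3 assms
      by (intro pot_average_drift) (auto simp: up_def down_def edge_def add_ac diff_right_commute)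
  qed
qed

lemma pot_start: "d x = 0 \<Longrightarrow> pot d t x \<le> 1"
  using corr_bounds(2) by (simp add: pot_def min.coboundedI1)

section \<open>Escape probabilities and merging times\<close>

lemma cap_pos: "0 < cap"
  using rate_gt_1 by (simp add: cap_def)

lemma left_escape: "(\<Sum>y\<in>{Suc m..N}. iter_kernel {0..N} kernel t 0 y) \<le> (1 + 2 * real t) / cap"
proof -
  have "(\<Sum>y\<in>{Suc m..N}. iter_kernel {0..N} kernel t 0 y) \<le> (pot id 0 0 + 2 * real t) / cap"
    by (rule iter_kernel_markov_ineq[where h = "pot id"])
      (auto simp: markov_kernel left_step pot_nonneg pot_far cap_pos)
  also have "\<dots> \<le> (1 + 2 * real t) / cap"
    using cap_pos pot_start[of id 0 0] by (intro divide_right_mono) auto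
  finally show ?thesis .
qed

lemma right_escape: "(\<Sum>y\<in>{0..m}. iter_kernel {0..N} kernel t N y) \<le> (1 + 2 * real t) / cap"
proof -
  have "(\<Sum>y\<in>{0..m}. iter_kernel {0..N} kernel t N y) \<le> (pot (\<lambda>x. N - x) 0 N + 2 * real t) / cap"
    by (rule iter_kernel_markov_ineq[where h = "pot (\<lambda>x. N - x)"])
      (use m_le in \<open>auto simp: markov_kernel right_step pot_nonneg pot_far cap_pos\<close>)
  also have "\<dots> \<le> (1 + 2 * real t) / cap"
    using cap_pos pot_start[of "\<lambda>x. N - x" N 0] by (intro divide_right_mono) auto
  finally show ?thesis .
qed

lemma separation:
  assumes "24 * real t \<le> rate ^ m"
  shows "3/4 \<le> (\<Sum>y\<in>{0..m}. iter_kernel {0..N} kernel t 0 y)"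
    and "(\<Sum>y\<in>{0..m}. iter_kernel {0..N} kernel t N y) \<le> 1/4"
proof -
  let ?P = "iter_kernel {0..N} kernel t"
  have "3/4 \<le> (\<Sum>y\<in>{0..m}. ?P 0 y) \<and> (\<Sum>y\<in>{0..m}. ?P N y) \<le> 1/4"
  \<comment> \<open>For \<open>t\<close> \<ge> 1 the escape bound is at most 3\<open>t\<close> /
    \<open>cap\<close> = 6\<open>t\<close> / \<open>rate ^ m\<close> \<le> 6/24. At time 0 it may
    exceed 1/4, but the walkers have not moved.\<close>
  proof (cases "t = 0")
    case True
    then show ?thesis using m_less by simp
  next
    case False
    then have small: "(1 + 2 * real t) / cap \<le> 1/4"
      using assms cap_pos by (simp add: cap_def pos_divide_le_eq)
    have "(\<Sum>y\<in>{0..N}. ?P 0 y) = 1"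
      using iter_kernel_prob_vector[of "{0..N}" kernel 0 t] markov_kernel
      by (simp add: prob_vector_def)
    moreover have "{0..N} = {0..m} \<union> {Suc m..N}" using m_less by auto
    moreover have "(\<Sum>y\<in>{0..m} \<union> {Suc m..N}. ?P 0 y)
        = (\<Sum>y\<in>{0..m}. ?P 0 y) + (\<Sum>y\<in>{Suc m..N}. ?P 0 y)"
      by (rule sum.union_disjoint) auto
    ultimately have "(\<Sum>y\<in>{0..m}. ?P 0 y) + (\<Sum>y\<in>{Suc m..N}. ?P 0 y) = 1" by simp
    then show ?thesis using left_escape[of t] right_escape[of t] small by linarith
  qed
  then show "3/4 \<le> (\<Sum>y\<in>{0..m}. ?P 0 y)" "(\<Sum>y\<in>{0..m}. ?P N y) \<le> 1/4" by auto
qed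

lemma merging_times:
  assumes "24 * T \<le> rate ^ m"
  shows "ereal T \<le> ereal_of_enat (tv_merging_time {0..N} kernel (1/2))"
    and "ereal T \<le> ereal_of_enat (relsup_merging_time {0..N} kernel (1/2))"
proof -
  have sep: "3/4 \<le> (\<Sum>z\<in>{0..m}. iter_kernel {0..N} kernel t 0 z)
      \<and> (\<Sum>z\<in>{0..m}. iter_kernel {0..N} kernel t N z) \<le> 1/4" if "real t < T" for t
    using separation[of t] that assms by simp
  have prob: "prob_vector {0..N} (iter_kernel {0..N} kernel t N)" for t
    by (rule iter_kernel_prob_vector) (auto simp: markov_kernel)
  have sub: "{0..m} \<subseteq> {0..N}" using m_less by auto
  show "ereal T \<le> ereal_of_enat (tv_merging_time {0..N} kernel (1/2))"
    by (rule merging_times_ge(1)[OF _ _ _ sub prob sep]) auto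
  show "ereal T \<le> ereal_of_enat (relsup_merging_time {0..N} kernel (1/2))"
    by (rule merging_times_ge(2)[OF _ _ _ sub prob sep]) auto
qed

end

section \<open>Choice of the constants\<close>

theorem proposition1p1:
  fixes \<epsilon> :: real
  assumes "\<epsilon> > 0"
  shows "\<exists>\<alpha>::real. \<alpha> > 0 \<and> (\<forall>N::nat. N \<ge> 1 \<longrightarrow>
    (\<exists>K :: nat \<Rightarrow> nat \<Rightarrow> nat \<Rightarrow> real.
      (\<forall>t.
        birth_death_kernel N (K t) \<and>
        (\<forall>x\<in>{0..N}. \<forall>y\<in>{0..N}. \<bar>int x - int y\<bar> \<le> 1 \<and> (x, y) \<noteq> (0, 0) \<and> (x, y) \<noteq> (N, N) \<longrightarrow>
          K t x y \<in> {1/3 - \<epsilon> .. 1/3 + \<epsilon>}) \<and>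
        K t 0 0 \<in> {2/3 - \<epsilon> .. 2/3 + \<epsilon>} \<and>
        K t N N \<in> {2/3 - \<epsilon> .. 2/3 + \<epsilon>} \<and>
        (\<exists>\<mu> :: nat \<Rightarrow> real. prob_vector {0..N} \<mu> \<and> reversible_for {0..N} (K t) \<mu> \<and>
          (\<forall>x\<in>{0..N}. (real N + 1) * \<mu> x \<in> {1 - \<epsilon> .. 1 + \<epsilon>}))) \<and>
      ereal_of_enat (tv_merging_time {0..N} K (1/2)) \<ge> ereal (\<alpha> * exp (\<alpha> * real N)) \<and>
      ereal_of_enat (relsup_merging_time {0..N} K (1/2)) \<ge> ereal (\<alpha> * exp (\<alpha> * real N))))"
proof -
  \<comment> \<open>The largest deviation to fit within \<epsilon> is the 3\<delta> of the
    reversible measure.\<close>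
  define \<delta> where "\<delta> = min (\<epsilon> / 3) (1/10)"
  have \<delta>: "0 < \<delta>" "\<delta> \<le> 1/10" "3 * \<delta> \<le> \<epsilon>" using assms by (auto simp: \<delta>_def)
  define z where "z = 1 + \<delta>\<^sup>2"
  have z: "1 < z" "z \<le> 2"
    using \<delta> power_le_one[of \<delta> 2] by (auto simp: z_def)
  \<comment> \<open>Half of \<open>ln z\<close> because \<open>m\<close> is about
    \<open>N\<close>/2; 1/48 absorbs the 24 of the separation bound and a rounding factor 2.\<close>
  define \<alpha> where "\<alpha> = min (1/48) (ln z / 2)"
  have \<alpha>: "0 < \<alpha>" "\<alpha> \<le> 1/48" "2 * \<alpha> \<le> ln z" using z by (auto simp: \<alpha>_def)
  show ?thesis
  proof (intro exI[of _ \<alpha>] conjI allI impI)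
    fix N :: nat
    assume N: "N \<ge> 1"
    define m where "m = (N - 1) div 2"
    have m: "2 * m < N" "N \<le> 2 * Suc m" using N by (auto simp: m_def)
    interpret ratchet \<delta> N m using \<delta> m by unfold_locales auto
    have rate_z: "rate = z" by (simp add: rate_def z_def)
    \<comment> \<open>Rounding \<open>N\<close>/2 up to \<open>Suc m\<close> costs one factor
      \<open>z\<close> \<le> 2.\<close>
    have "\<alpha> * real N \<le> \<alpha> * (2 * real (Suc m))"
      using \<alpha> m by (intro mult_left_mono) auto
    also have "\<dots> = real (Suc m) * (2 * \<alpha>)" by simp
    also have "\<dots> \<le> real (Suc m) * ln z" using \<alpha> by (intro mult_left_mono) auto
    finally have "exp (\<alpha> * real N) \<le> exp (real (Suc m) * ln z)" by simp
    also have "\<dots> = z ^ Suc m" using z by (simp only: exp_of_nat_mult exp_ln)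
    also have "\<dots> \<le> 2 * z ^ m" using z by simp
    finally have e: "exp (\<alpha> * real N) \<le> 2 * z ^ m" .
    have "24 * (\<alpha> * exp (\<alpha> * real N)) \<le> 24 * (1/48 * (2 * z ^ m))"
      using \<alpha> e by (intro mult_left_mono mult_mono) auto
    then have T: "24 * (\<alpha> * exp (\<alpha> * real N)) \<le> rate ^ m" by (simp add: rate_z)
    have b: "v \<in> {c - \<epsilon> .. c + \<epsilon>}" if "\<bar>v - c\<bar> \<le> 3 * \<delta>" for v c :: real
      using that \<delta> by (auto simp: abs_le_iff)
    show "\<exists>K. (\<forall>t.
        birth_death_kernel N (K t) \<and>
        (\<forall>x\<in>{0..N}. \<forall>y\<in>{0..N}. \<bar>int x - int y\<bar> \<le> 1 \<and> (x, y) \<noteq> (0, 0) \<and> (x, y) \<noteq> (N, N) \<longrightarrow>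
          K t x y \<in> {1/3 - \<epsilon> .. 1/3 + \<epsilon>}) \<and>
        K t 0 0 \<in> {2/3 - \<epsilon> .. 2/3 + \<epsilon>} \<and>
        K t N N \<in> {2/3 - \<epsilon> .. 2/3 + \<epsilon>} \<and>
        (\<exists>\<mu> :: nat \<Rightarrow> real. prob_vector {0..N} \<mu> \<and> reversible_for {0..N} (K t) \<mu> \<and>
          (\<forall>x\<in>{0..N}. (real N + 1) * \<mu> x \<in> {1 - \<epsilon> .. 1 + \<epsilon>}))) \<and>
      ereal_of_enat (tv_merging_time {0..N} K (1/2)) \<ge> ereal (\<alpha> * exp (\<alpha> * real N)) \<and>
      ereal_of_enat (relsup_merging_time {0..N} K (1/2)) \<ge> ereal (\<alpha> * exp (\<alpha> * real N))"
    proof (intro exI[of _ kernel] conjI allI ballI impI)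
      fix t
      show "birth_death_kernel N (kernel t)" by (rule birth_death)
      show "kernel t 0 0 \<in> {2/3 - \<epsilon> .. 2/3 + \<epsilon>}" "kernel t N N \<in> {2/3 - \<epsilon> .. 2/3 + \<epsilon>}"
        using kernel_bounds_ends[of t] \<delta> by (intro b; linarith)+
      show "\<exists>\<mu>. prob_vector {0..N} \<mu> \<and> reversible_for {0..N} (kernel t) \<mu> \<and>
          (\<forall>x\<in>{0..N}. (real N + 1) * \<mu> x \<in> {1 - \<epsilon> .. 1 + \<epsilon>})"
        using reversible_measure[of t] b by blast
      fix x y
      assume "x \<in> {0..N}" "y \<in> {0..N}"
        "\<bar>int x - int y\<bar> \<le> 1 \<and> (x, y) \<noteq> (0, 0) \<and> (x, y) \<noteq> (N, N)"
      then have "\<bar>kernel t x y - 1/3\<bar> \<le> 2 * \<delta>" by (intro kernel_bounds) auto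
      then show "kernel t x y \<in> {1/3 - \<epsilon> .. 1/3 + \<epsilon>}" using \<delta> by (intro b) linarith
    qed (use merging_times[OF T] in auto)
  qed (use \<alpha> in auto)
qed

end
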